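(* Let $X$ be an infinite metrizable space which has the Hurewicz property. Then the following are equivalent: (1) $X$ has property $\mathsf{S}_c(\mathcal{O},\mathcal{O})$. (2) $X$ has property $\mathsf{S}_c(\mathcal{O}_{fin},\mathcal{O})$.
   Context: Sequences $(\cdot_n : n<\infty)$ are indexed by the natural numbers. A topological space $X$ has the Hurewicz property if for each sequence $(\mathcal{U}_n : n<\infty)$ of open covers of $X$ there is a sequence $(\mathcal{V}_n : n<\infty)$ such that for each $n$, $\mathcal{V}_n$ is a finite subset of $\mathcal{U}_n$, and each element of $X$ is in all but finitely many of the sets $\bigcup\mathcal{V}_n$. A family $B$ of sets refines a family $A$ if each element of $B$ is a subset of some element of $A$ (it is not required that $\bigcup B=\bigcup A$). For an infinite set $X$ and collections $\mathcal{A},\mathcal{B}$ of families of subsets of $X$, the selection principle $\mathsf{S}_c(\mathcal{A},\mathcal{B})$ states: for each sequence $(A_n : n<\infty)$ of elements of $\mathcal{A}$ there is a sequence $(B_n : n<\infty)$ such that for each $n$, $B_n$ is a pairwise disjoint family refining $A_n$, and $\bigcup_{n<\infty}B_n$ is a member of $\mathcal{B}$. For a topological space $X$, $\mathcal{O}$ denotes the collection of all open covers of $X$, and $\mathcal{O}_{fin}$ denotes the collection of all finite open covers of $X$. *)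

theory Defs
  imports "HOL-Analysis.Analysis"
begin

definition open_covers :: "'a topology \<Rightarrow> 'a set set set" where
  "open_covers X = {\<U>. (\<forall>U\<in>\<U>. openin X U) \<and> \<Union>\<U> = topspace X}"

definition finite_open_covers :: "'a topology \<Rightarrow> 'a set set set" where
  "finite_open_covers X = {\<U> \<in> open_covers X. finite \<U>}"

(* "All but finitely many" counts indices n, not distinct sets. *)
definition Hurewicz_space :: "'a topology \<Rightarrow> bool" where
  "Hurewicz_space X \<longleftrightarrow>
    (\<forall>\<U>::nat \<Rightarrow> 'a set set. (\<forall>n. \<U> n \<in> open_covers X) \<longrightarrow>
      (\<exists>\<V>::nat \<Rightarrow> 'a set set.
        (\<forall>n. finite (\<V> n) \<and> \<V> n \<subseteq> \<U> n) \<and>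
        (\<forall>x\<in>topspace X. finite {n. x \<notin> \<Union>(\<V> n)})))"

(* The two families need not have the same union. *)
definition family_refines :: "'a set set \<Rightarrow> 'a set set \<Rightarrow> bool" where
  "family_refines B A \<longleftrightarrow> (\<forall>b\<in>B. \<exists>a\<in>A. b \<subseteq> a)"

definition S_c :: "'a set set set \<Rightarrow> 'a set set set \<Rightarrow> bool" where
  "S_c \<A> \<B> \<longleftrightarrow>
    (\<forall>A::nat \<Rightarrow> 'a set set. (\<forall>n. A n \<in> \<A>) \<longrightarrow>
      (\<exists>B::nat \<Rightarrow> 'a set set.
        (\<forall>n. pairwise disjnt (B n) \<and> family_refines (B n) (A n)) \<and>
        (\<Union>n. B n) \<in> \<B>))"

end

theory Submission
  imports Defs
begin

text \<open>
  One implication holds because \<open>S_c\<close> is antitone in the class of given covers. For the other one,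
  the Hurewicz property serves to write \<open>X\<close> as a countable union of closed sets \<open>C m\<close> such that
  every given cover with index \<open>n \<ge> m\<close> has a finite subfamily covering \<open>C m\<close>
  (lemma \<open>Hurewicz_closed_decomposition\<close>). The plain Hurewicz property only yields sets that are
  intersections of open sets; they become closed after the covers are first shrunk so that the
  closures of the new members still fit into members of the old covers. Metrizability enters
  through this shrinking, which is a matter of regularity.

  On a single closed set, finite families of open sets that cover it behave like finite covers of
  \<open>X\<close>: add the complement, select, and discard the selected sets that miss the closed set
  (lemma \<open>S_c_finite_on_closed\<close>). To treat all \<open>C m\<close> at once, the index set is split
  into infinitely many infinite pieces, and the covers indexed by the \<open>m\<close>-th piece are spent on
  \<open>C m\<close>. Every index in the \<open>m\<close>-th piece is at least \<open>m\<close>, so each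
  cover used there does have a finite subfamily covering \<open>C m\<close>.
\<close>

lemma S_c_antimono: "\<A>' \<subseteq> \<A> \<Longrightarrow> S_c \<A> \<B> \<Longrightarrow> S_c \<A>' \<B>"
  unfolding S_c_def by blast

lemma regular_space_closure_shrinking:
  assumes "regular_space X" and U: "\<U> \<in> open_covers X"
  shows "{W. openin X W \<and> (\<exists>U\<in>\<U>. X closure_of W \<subseteq> U)} \<in> open_covers X"
proof -
  have "\<exists>W. openin X W \<and> (\<exists>U\<in>\<U>. X closure_of W \<subseteq> U) \<and> x \<in> W" if x: "x \<in> topspace X" for x
  proof -
    obtain U where U': "U \<in> \<U>" "x \<in> U" "openin X U"
      using U x by (auto simp: open_covers_def)
    moreover have "neighbourhood_base_of (closedin X) X"
      using assms(1) neighbourhood_base_of_closedin by blast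
    ultimately obtain W K where "openin X W" "closedin X K" "x \<in> W" "W \<subseteq> K" "K \<subseteq> U"
      unfolding neighbourhood_base_of by metis
    then show ?thesis
      using U' closure_of_minimal by (metis order_trans)
  qed
  then show ?thesis
    by (auto simp: open_covers_def dest: openin_subset)
qed

text \<open>
  A point lies in \<open>C m\<close> if, from index \<open>m\<close> on, it is always in the closure of a set that the Hurewicz
  property selects from the shrunken covers. Each selection is finite, so the union of these
  closures is closed and is covered by finitely many members of the original cover.
\<close>

lemma Hurewicz_closed_decomposition:
  assumes "regular_space X" "Hurewicz_space X"
    and U: "\<And>n. \<U> n \<in> open_covers X"
  obtains C :: "nat \<Rightarrow> 'a set" and \<F>
  where "\<And>m. closedin X (C m)" "(\<Union>m. C m) = topspace X"
    and "\<And>n. finite (\<F> n)" "\<And>n. \<F> n \<subseteq> \<U> n"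
    and "\<And>m n. m \<le> n \<Longrightarrow> C m \<subseteq> \<Union>(\<F> n)"
proof -
  let ?S = "\<lambda>n. {W. openin X W \<and> (\<exists>U\<in>\<U> n. X closure_of W \<subseteq> U)}"
  have "\<forall>n. ?S n \<in> open_covers X"
    using regular_space_closure_shrinking[OF assms(1) U] by blast
  with assms(2) have "\<exists>\<V>. (\<forall>n. finite (\<V> n) \<and> \<V> n \<subseteq> ?S n) \<and>
      (\<forall>x\<in>topspace X. finite {n. x \<notin> \<Union>(\<V> n)})"
    unfolding Hurewicz_space_def by (elim allE[of _ ?S] impE)
  then obtain \<V> where "\<forall>n. finite (\<V> n) \<and> \<V> n \<subseteq> ?S n"
    and fin: "\<forall>x\<in>topspace X. finite {n. x \<notin> \<Union>(\<V> n)}"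
    by (elim exE conjE) (rule that)
  then have V: "finite (\<V> n)" "\<V> n \<subseteq> ?S n" for n
    by simp_all
  have "\<forall>n. \<forall>W\<in>\<V> n. \<exists>U\<in>\<U> n. X closure_of W \<subseteq> U"
    using V(2) by blast
  then obtain g where g: "\<And>n W. W \<in> \<V> n \<Longrightarrow> g n W \<in> \<U> n \<and> X closure_of W \<subseteq> g n W"
    by metis
  define K where "K n = (\<Union>W\<in>\<V> n. X closure_of W)" for n
  define C where "C m = (\<Inter>n\<in>{m..}. K n)" for m
  have closedK: "closedin X (K n)" for n
    unfolding K_def using V(1) by (intro closedin_Union) auto
  have VK: "\<Union>(\<V> n) \<subseteq> K n" for n
  proof -
    have "W \<subseteq> X closure_of W" if "W \<in> \<V> n" for W
      using that V(2)[of n] by (intro closure_of_subset openin_subset) auto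
    then show ?thesis
      unfolding K_def by blast
  qed
  show thesis
  proof
    show clC: "closedin X (C m)" for m
      unfolding C_def by (intro closedin_Inter) (use closedK in auto)
    show "(\<Union>m. C m) = topspace X"
    proof
      show "(\<Union>m. C m) \<subseteq> topspace X"
        using clC closedin_subset by blast
      show "topspace X \<subseteq> (\<Union>m. C m)"
      proof
        fix x assume "x \<in> topspace X"
        then obtain m where "\<forall>n\<in>{n. x \<notin> \<Union>(\<V> n)}. n < m"
          using fin finite_nat_set_iff_bounded by blast
        then have "x \<in> C m"
          unfolding C_def using VK by (force simp: not_less[symmetric])
        then show "x \<in> (\<Union>m. C m)" by blast
      qed
    qed
    show "finite (g n ` \<V> n)" for n
      using V(1) by blast
    show "g n ` \<V> n \<subseteq> \<U> n" for n
      using g by blast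
    show "C m \<subseteq> \<Union>(g n ` \<V> n)" if "m \<le> n" for m n
    proof -
      have "C m \<subseteq> K n"
        unfolding C_def using that by blast
      also have "K n \<subseteq> \<Union>(g n ` \<V> n)"
        unfolding K_def using g by blast
      finally show ?thesis .
    qed
  qed
qed

text \<open>
  Adding the complement of \<open>C\<close> turns each family into a finite open cover of the whole space. A
  selected set that meets \<open>C\<close> is not contained in this complement, hence lies in a member of the
  original family; and the selected sets that meet \<open>C\<close> are enough to cover it.
\<close>

lemma S_c_finite_on_closed:
  assumes Sc: "S_c (finite_open_covers X) (open_covers X)"
    and C: "closedin X C"
    and F: "\<And>k::nat. finite (\<F> k)" "\<And>k U. U \<in> \<F> k \<Longrightarrow> openin X U" "\<And>k. C \<subseteq> \<Union>(\<F> k)"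
  shows "\<exists>B. (\<forall>k. pairwise disjnt (B k) \<and> family_refines (B k) (\<F> k) \<and> (\<forall>b\<in>B k. openin X b)) \<and>
    C \<subseteq> (\<Union>k. \<Union>(B k))"
proof -
  define G where "G k = insert (topspace X - C) (\<F> k)" for k
  have "G k \<in> finite_open_covers X" for k
  proof -
    have "openin X (topspace X - C)"
      using C by blast
    moreover have "\<Union>(\<F> k) \<subseteq> topspace X"
      using F(2) openin_subset by blast
    ultimately show ?thesis
      using F[where k=k] by (auto simp: G_def finite_open_covers_def open_covers_def)
  qed
  then obtain A where A: "\<And>k. pairwise disjnt (A k)" "\<And>k. family_refines (A k) (G k)"
    and cov: "(\<Union>k. A k) \<in> open_covers X"
    using Sc unfolding S_c_def by metis
  let ?B = "\<lambda>k. {b \<in> A k. b \<inter> C \<noteq> {}}"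
  have "pairwise disjnt (?B k)" for k
    using A(1)[of k] by (rule pairwise_subset) blast
  moreover have "family_refines (?B k) (\<F> k)" for k
    using A(2)[of k] unfolding family_refines_def G_def by blast
  moreover have "\<forall>b\<in>?B k. openin X b" for k
    using cov by (auto simp: open_covers_def)
  moreover have "C \<subseteq> (\<Union>k. \<Union>(?B k))"
  proof
    fix x assume "x \<in> C"
    moreover have "C \<subseteq> \<Union>(\<Union>k. A k)"
      using cov closedin_subset[OF C] by (auto simp: open_covers_def)
    ultimately obtain k b where "b \<in> A k" "x \<in> b" by blast
    then show "x \<in> (\<Union>k. \<Union>(?B k))"
      using \<open>x \<in> C\<close> by blast
  qed
  ultimately show ?thesis
    by (intro exI[of _ ?B] conjI allI)
qed

lemma S_c_open_covers_if_finite_open_covers: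
  assumes "regular_space X" "Hurewicz_space X"
    and Sc: "S_c (finite_open_covers X) (open_covers X)"
  shows "S_c (open_covers X) (open_covers X)"
  unfolding S_c_def
proof (intro allI impI)
  fix \<U> :: "nat \<Rightarrow> 'a set set"
  assume "\<forall>n. \<U> n \<in> open_covers X"
  then have U: "\<And>n. \<U> n \<in> open_covers X" by blast
  obtain C :: "nat \<Rightarrow> 'a set" and \<F> where C: "\<And>m. closedin X (C m)" "(\<Union>m. C m) = topspace X"
    and F: "\<And>n. finite (\<F> n)" "\<And>n. \<F> n \<subseteq> \<U> n" "\<And>m n. m \<le> n \<Longrightarrow> C m \<subseteq> \<Union>(\<F> n)"
    using Hurewicz_closed_decomposition[of X \<U>, OF assms(1,2) U] by blast
  have F_open: "openin X V" if "V \<in> \<F> n" for n V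
    using that F(2) U by (force simp: open_covers_def)
  \<comment> \<open>The \<open>m\<close>-th piece of the index set consists of the codes of the pairs \<open>(m, k)\<close>;
    such a code is at least \<open>m\<close>.\<close>
  have "\<forall>m. \<exists>B. (\<forall>k. pairwise disjnt (B k) \<and> family_refines (B k) (\<F> (prod_encode (m, k))) \<and>
      (\<forall>b\<in>B k. openin X b)) \<and> C m \<subseteq> (\<Union>k. \<Union>(B k))"
    by (intro allI S_c_finite_on_closed Sc C F(1,3) le_prod_encode_1) (rule F_open)
  from choice[OF this] obtain B
    where "\<forall>m. (\<forall>k. pairwise disjnt (B m k) \<and> family_refines (B m k) (\<F> (prod_encode (m, k))) \<and>
      (\<forall>b\<in>B m k. openin X b)) \<and> C m \<subseteq> (\<Union>k. \<Union>(B m k))"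
    by (rule exE)
  then have B: "pairwise disjnt (B m k)" "family_refines (B m k) (\<F> (prod_encode (m, k)))"
      "\<forall>b\<in>B m k. openin X b" "C m \<subseteq> (\<Union>k. \<Union>(B m k))" for m k
    by simp_all
  define A where "A n = (case prod_decode n of (m, k) \<Rightarrow> B m k)" for n
  have A_encode: "A (prod_encode (m, k)) = B m k" for m k
    by (simp add: A_def)
  have A_prop: "pairwise disjnt (A n) \<and> family_refines (A n) (\<U> n) \<and> (\<forall>b\<in>A n. openin X b)" for n
  proof -
    obtain m k where n: "n = prod_encode (m, k)"
      by (metis prod_decode_inverse surj_pair)
    have "family_refines (B m k) (\<U> n)"
      using B(2)[of m k] F(2)[of n] unfolding family_refines_def n by blast
    then show ?thesis
      using B(1,3) by (simp add: n A_encode)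
  qed
  have "\<Union>(\<Union>n. A n) = topspace X"
  proof
    show "\<Union>(\<Union>n. A n) \<subseteq> topspace X"
      using A_prop openin_subset by blast
    have "C m \<subseteq> \<Union>(\<Union>n. A n)" for m
      using B(4)[of m] unfolding A_encode[symmetric] by blast
    then show "topspace X \<subseteq> \<Union>(\<Union>n. A n)"
      unfolding C(2)[symmetric] by (rule UN_least)
  qed
  then have "(\<Union>n. A n) \<in> open_covers X"
    using A_prop by (auto simp: open_covers_def)
  then show "\<exists>B. (\<forall>n. pairwise disjnt (B n) \<and> family_refines (B n) (\<U> n)) \<and>
      (\<Union>n. B n) \<in> open_covers X"
    using A_prop by (intro exI[of _ A]) simp
qed

theorem theorem4:
  fixes X :: "'a topology"
  assumes "infinite (topspace X)"
    and "metrizable_space X"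
    and "Hurewicz_space X"
  shows "S_c (open_covers X) (open_covers X) \<longleftrightarrow>
         S_c (finite_open_covers X) (open_covers X)"
proof
  assume "S_c (open_covers X) (open_covers X)"
  then show "S_c (finite_open_covers X) (open_covers X)"
    by (rule S_c_antimono[rotated]) (auto simp: finite_open_covers_def)
next
  assume "S_c (finite_open_covers X) (open_covers X)"
  then show "S_c (open_covers X) (open_covers X)"
    using S_c_open_covers_if_finite_open_covers assms(2,3) metrizable_imp_regular_space by blast
qed

end
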